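(* Let $\varphi_e$ and $\varphi_{e_1}$ be two ruled surfaces in $\mathbb{R}^3$ that form a Bertrand surface offset, with offset angle $\theta$ and offset distance $\theta^*$. Then the arc-length parameters $s$ and $s_1$ satisfy $$s_1=s\cos\theta+\left(\int_0^{s}\gamma\,ds\right)\sin\theta,$$ $$\int_0^{s_1}\Delta_1\,du_1=\left(\int_0^{s}(\gamma\Delta+\gamma^* )\,ds\right)\sin\theta+\left(\int_0^{s}\Delta\,du\right)\cos\theta+\theta^*\left[\left(\int_0^{s}\gamma\,ds\right)\cos\theta-s\sin\theta\right].$$
   Context: Dual numbers are $\bar a=a+\varepsilon a^*$ with $a,a^*\in\mathbb{R}$, $\varepsilon\neq 0$, $\varepsilon^2=0$. For a differentiable real function $f$, $f(x+\varepsilon x^* )=f(x)+\varepsilon x^*f'(x)$; e.g. $\cos(x+\varepsilon x^* )=\cos x-\varepsilon x^*\sin x$, $\sin(x+\varepsilon x^* )=\sin x+\varepsilon x^*\cos x$. Dual vectors are $\tilde a=\vec a+\varepsilon\vec a^*$ with $\vec a,\vec a^*\in\mathbb{R}^3$; scalar and vector products are extended $\varepsilon$-bilinearly. A ruled surface $\varphi_e=\vec c(s)+v\,\vec e(s)$ (all data smooth) is parametrized so that $\langle \vec e,\vec e\rangle=1$, $\langle \vec e',\vec e'\rangle=1$, $\langle \vec c',\vec e'\rangle=0$, where prime is $d/ds$; so $s$ is the arc length of the real indicatrix $\vec e(s)$ and $\vec c$ is the striction line. It is represented by the dual unit vector $\tilde e=\vec e+\varepsilon\,\vec c\times\vec e$.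 Put $\vec t=\vec e'$, $\vec g=\vec e\times\vec t$; the conical curvature $\gamma$ is defined by $\vec e'=\vec t$, $\vec t'=\gamma\vec g-\vec e$, $\vec g'=-\gamma\vec t$. Put $\Delta=\det(\vec c',\vec e,\vec t)$, $\delta=\langle\vec c',\vec e\rangle$. The dual Darboux frame is $\{\tilde e,\tilde t,\tilde g\}$ with $\tilde t=\vec t+\varepsilon\,\vec c\times\vec t$, $\tilde g=\vec g+\varepsilon\,\vec c\times\vec g$. The dual arc-length is $\bar s=s+\varepsilon\int_0^s\Delta\,du$. The dual conical curvature is $\bar\gamma=\gamma+\varepsilon\gamma^*$ with $\gamma^*=\delta-\gamma\Delta$. The corresponding objects of a second ruled surface $\varphi_{e_1}$ (with its own parameter $s_1$) carry the subscript $1$. $\varphi_e$ and $\varphi_{e_1}$ form a Bertrand surface offset if, under a correspondence $s_1=s_1(s)$ between their rulings (differentiable with nonvanishing derivative), $\tilde t=\tilde t_1$ at corresponding parameters. The frames are then related by $\tilde e_1=\cos\bar\theta\,\tilde e-\sin\bar\theta\,\tilde g$, $\tilde t_1=\tilde t$, $\tilde g_1=\sin\bar\theta\,\tilde e+\cos\bar\theta\,\tilde g$, where $\bar\theta=\theta+\varepsilon\theta^*$ ($0\le\theta\le\pi$, $\theta^*\in\mathbb{R}$) is the dual angle between $\tilde e$ and $\tilde e_1$; $\theta$ is the offset angle and $\theta^*$ the offset distance. The arc lengths are measured from corresponding base points, i.e. $s_1=0$ corresponds to $s=0$. *)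

theory Defs
  imports "HOL-Analysis.Analysis"
begin

unbundle cross3_syntax

(* Dual a b stands for a + eps b with eps^2 = 0: dual numbers for 'a = real,
   dual vectors for 'a = real^3. *)
datatype 'a dual = Dual (re: 'a) (du: 'a)

instantiation dual :: (minus) minus
begin

definition minus_dual :: "'a dual \<Rightarrow> 'a dual \<Rightarrow> 'a dual" where
  "x - y = Dual (re x - re y) (du x - du y)"

instance ..

end

definition dual_scale :: "real dual \<Rightarrow> 'a::real_vector dual \<Rightarrow> 'a dual" where
  "dual_scale a x = Dual (re a *\<^sub>R re x) (re a *\<^sub>R du x + du a *\<^sub>R re x)"

definition dual_ext :: "(real \<Rightarrow> real) \<Rightarrow> real dual \<Rightarrow> real dual" where
  "dual_ext f x = Dual (f (re x)) (du x * deriv f (re x))"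

definition vderiv :: "(real \<Rightarrow> 'a::real_normed_vector) \<Rightarrow> real \<Rightarrow> 'a" where
  "vderiv f s = vector_derivative f (at s)"

(* Meant for open I: there the iterated derivatives at points of I depend only on f on I. *)
definition smooth_curve_on :: "real set \<Rightarrow> (real \<Rightarrow> 'a::real_normed_vector) \<Rightarrow> bool" where
  "smooth_curve_on I f \<longleftrightarrow> (\<forall>n. \<forall>s\<in>I. (vderiv ^^ n) f differentiable at s)"

(* c is the striction line and e the director curve of the surface c(s) + v e(s);
   the parameter s is the arc length of the spherical indicatrix e. *)
definition ruled_surface :: "real set \<Rightarrow> (real \<Rightarrow> real^3) \<Rightarrow> (real \<Rightarrow> real^3) \<Rightarrow> bool" where
  "ruled_surface I c e \<longleftrightarrow>
     open I \<and> is_interval I \<and> 0 \<in> I \<and> smooth_curve_on I c \<and> smooth_curve_on I e \<and>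
     (\<forall>s\<in>I. e s \<bullet> e s = 1 \<and> vderiv e s \<bullet> vderiv e s = 1 \<and> vderiv c s \<bullet> vderiv e s = 0)"

definition tvec :: "(real \<Rightarrow> real^3) \<Rightarrow> real \<Rightarrow> real^3" where
  "tvec e = vderiv e"

definition gvec :: "(real \<Rightarrow> real^3) \<Rightarrow> real \<Rightarrow> real^3" where
  "gvec e s = e s \<times> tvec e s"

(* The equations determine the value uniquely on every ruled surface: see ex1_conical_curv. *)
definition conical_curv :: "(real \<Rightarrow> real^3) \<Rightarrow> real \<Rightarrow> real" where
  "conical_curv e s =
     (THE k. vderiv (tvec e) s = k *\<^sub>R gvec e s - e s \<and> vderiv (gvec e) s = - k *\<^sub>R tvec e s)"

definition Delta :: "(real \<Rightarrow> real^3) \<Rightarrow> (real \<Rightarrow> real^3) \<Rightarrow> real \<Rightarrow> real" where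
  "Delta c e s = det (vector [vderiv c s, e s, tvec e s] :: real^3^3)"

definition delta :: "(real \<Rightarrow> real^3) \<Rightarrow> (real \<Rightarrow> real^3) \<Rightarrow> real \<Rightarrow> real" where
  "delta c e s = vderiv c s \<bullet> e s"

definition dual_conical_curv ::
    "(real \<Rightarrow> real^3) \<Rightarrow> (real \<Rightarrow> real^3) \<Rightarrow> real \<Rightarrow> real dual" where
  "dual_conical_curv c e s =
     Dual (conical_curv e s) (delta c e s - conical_curv e s * Delta c e s)"

(* The oriented line through the point p with unit direction x. *)
definition dual_line :: "real^3 \<Rightarrow> real^3 \<Rightarrow> (real^3) dual" where
  "dual_line p x = Dual x (p \<times> x)"

definition dual_e :: "(real \<Rightarrow> real^3) \<Rightarrow> (real \<Rightarrow> real^3) \<Rightarrow> real \<Rightarrow> (real^3) dual" where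
  "dual_e c e s = dual_line (c s) (e s)"

definition dual_t :: "(real \<Rightarrow> real^3) \<Rightarrow> (real \<Rightarrow> real^3) \<Rightarrow> real \<Rightarrow> (real^3) dual" where
  "dual_t c e s = dual_line (c s) (tvec e s)"

definition dual_g :: "(real \<Rightarrow> real^3) \<Rightarrow> (real \<Rightarrow> real^3) \<Rightarrow> real \<Rightarrow> (real^3) dual" where
  "dual_g c e s = dual_line (c s) (gvec e s)"

(* Oriented from 0 to x, so negative arc lengths are covered. The integral of Delta c e
   is the dual part of the dual arc length. *)
definition int0 :: "(real \<Rightarrow> real) \<Rightarrow> real \<Rightarrow> real" where
  "int0 f x = (LBINT u=ereal 0..ereal x. f u)"

(* phi s is the parameter on the second surface of the ruling corresponding to s;
   phi 0 = 0 says that both arc lengths are measured from corresponding base points. *)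
definition bertrand_offset ::
    "real set \<Rightarrow> (real \<Rightarrow> real^3) \<Rightarrow> (real \<Rightarrow> real^3) \<Rightarrow>
     real set \<Rightarrow> (real \<Rightarrow> real^3) \<Rightarrow> (real \<Rightarrow> real^3) \<Rightarrow> (real \<Rightarrow> real) \<Rightarrow> bool" where
  "bertrand_offset I c e I1 c1 e1 phi \<longleftrightarrow>
     phi ` I \<subseteq> I1 \<and> phi 0 = 0 \<and>
     (\<forall>s\<in>I. phi differentiable at s \<and> deriv phi s \<noteq> 0) \<and>
     (\<forall>s\<in>I. dual_t c1 e1 (phi s) = dual_t c e s)"

(* th is the dual angle from dual_e to dual_e1 in the sense of the relation between the
   dual Darboux frames. Together with equality of the dual t-vectors, the first relation
   implies the one for dual_g. *)
definition dual_offset_angle ::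
    "(real \<Rightarrow> real^3) \<Rightarrow> (real \<Rightarrow> real^3) \<Rightarrow> (real \<Rightarrow> real^3) \<Rightarrow> (real \<Rightarrow> real^3) \<Rightarrow>
     (real \<Rightarrow> real) \<Rightarrow> real \<Rightarrow> real dual \<Rightarrow> bool" where
  "dual_offset_angle c e c1 e1 phi s th \<longleftrightarrow>
     0 \<le> re th \<and> re th \<le> pi \<and>
     dual_e c1 e1 (phi s) =
       dual_scale (dual_ext cos th) (dual_e c e s) - dual_scale (dual_ext sin th) (dual_g c e s)"

lemma smooth_curve_on_vderiv:
  assumes "smooth_curve_on I f" "s \<in> I"
  shows "(f has_vector_derivative vderiv f s) (at s)"
    "(vderiv f has_vector_derivative vderiv (vderiv f) s) (at s)"
proof -
  have "(vderiv ^^ 0) f differentiable at s" "(vderiv ^^ 1) f differentiable at s"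
    using assms unfolding smooth_curve_on_def by blast+
  then show "(f has_vector_derivative vderiv f s) (at s)"
    "(vderiv f has_vector_derivative vderiv (vderiv f) s) (at s)"
    by (simp_all add: vderiv_def[of _ s] vector_derivative_works[symmetric])
qed

lemma deriv_inner_const:
  fixes f g :: "real \<Rightarrow> real^3"
  assumes "open I" "s \<in> I" "\<And>u. u \<in> I \<Longrightarrow> f u \<bullet> g u = k"
    and "(f has_vector_derivative f') (at s)" "(g has_vector_derivative g') (at s)"
  shows "f s \<bullet> g' + f' \<bullet> g s = 0"
proof -
  have "((\<lambda>u. f u \<bullet> g u) has_derivative (\<lambda>h. f s \<bullet> (h *\<^sub>R g') + (h *\<^sub>R f') \<bullet> g s)) (at s)"
    by (rule has_derivative_inner[OF assms(4,5)[unfolded has_vector_derivative_def]])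
  moreover have "((\<lambda>u. f u \<bullet> g u) has_derivative (\<lambda>h. 0)) (at s)"
    by (rule has_derivative_transform_within_open[OF has_derivative_const assms(1,2)])
      (simp add: assms(3))
  ultimately have "(\<lambda>h. f s \<bullet> (h *\<^sub>R g') + (h *\<^sub>R f') \<bullet> g s) = (\<lambda>h. 0)"
    by (rule has_derivative_unique)
  from fun_cong[OF this, of 1] show ?thesis by simp
qed

lemma ex1_conical_curv:
  assumes R: "ruled_surface I c e" and s: "s \<in> I"
  shows "\<exists>!k. vderiv (tvec e) s = k *\<^sub>R gvec e s - e s \<and>
              vderiv (gvec e) s = - k *\<^sub>R tvec e s"
proof -
  define a where "a = e s"
  define t where "t = tvec e s"
  define d where "d = vderiv (tvec e) s"
  define k where "k = d \<bullet> (a \<times> t)"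
  have I: "open I" and sm: "smooth_curve_on I e"
    and ee: "\<And>u. u \<in> I \<Longrightarrow> e u \<bullet> e u = 1"
    and tt: "\<And>u. u \<in> I \<Longrightarrow> tvec e u \<bullet> tvec e u = 1"
    using R by (auto simp: ruled_surface_def tvec_def)
  have e': "(e has_vector_derivative tvec e u) (at u)"
    and t': "(tvec e has_vector_derivative vderiv (tvec e) u) (at u)" if "u \<in> I" for u
    using smooth_curve_on_vderiv[OF sm that] by (simp_all add: tvec_def)
  have et: "e u \<bullet> tvec e u = 0" if "u \<in> I" for u
    using deriv_inner_const[OF I that ee e'[OF that] e'[OF that]] by (simp add: inner_commute)
  have h: "a \<bullet> a = 1" "t \<bullet> t = 1" "a \<bullet> t = 0" "t \<bullet> d = 0" "a \<bullet> d = - 1"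
    using ee[OF s] tt[OF s] et[OF s]
      deriv_inner_const[OF I s tt t'[OF s] t'[OF s]]
      deriv_inner_const[OF I s et e'[OF s] t'[OF s]]
    by (auto simp: a_def t_def d_def inner_commute)
  have ad: "a \<times> d = - k *\<^sub>R t"
  proof -
    have "t \<times> (a \<times> d) = (t \<bullet> d) *\<^sub>R a - (t \<bullet> a) *\<^sub>R d"
      by (rule Lagrange)
    then have 1: "t \<times> (a \<times> d) = 0"
      using h by (simp add: inner_commute)
    have "t \<bullet> (a \<times> d) = - k"
      unfolding k_def by (simp add: cross3_simps)
    moreover have "t \<times> (t \<times> (a \<times> d)) = (t \<bullet> (a \<times> d)) *\<^sub>R t - (t \<bullet> t) *\<^sub>R (a \<times> d)"
      by (rule Lagrange)
    ultimately show ?thesis using 1 h by simp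
  qed
  have "a \<times> (a \<times> d) = (a \<bullet> d) *\<^sub>R a - (a \<bullet> a) *\<^sub>R d" by (rule Lagrange)
  then have dk: "d = k *\<^sub>R (a \<times> t) - a" using h ad by (simp add: cross_mult_right algebra_simps)
  have "((\<lambda>u. e u \<times> tvec e u) has_vector_derivative (a \<times> d + t \<times> t)) (at s)"
    using bounded_bilinear.has_vector_derivative[OF bilinear_conv_bounded_bilinear[THEN iffD1, OF bilinear_cross] e'[OF s] t'[OF s]]
    by (simp add: a_def t_def d_def)
  then have "vderiv (gvec e) s = - k *\<^sub>R t"
    by (simp add: vderiv_def gvec_def[abs_def] vector_derivative_at ad)
  then have ex: "vderiv (tvec e) s = k *\<^sub>R gvec e s - e s \<and> vderiv (gvec e) s = - k *\<^sub>R tvec e s"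
    using dk by (simp add: a_def t_def d_def gvec_def)
  have "t \<noteq> 0" using h by auto
  then have "l = k" if "vderiv (gvec e) s = - l *\<^sub>R tvec e s" for l
    using that ex by (simp add: t_def)
  then show ?thesis using ex by blast
qed

end

theory Submission
  imports Defs
begin

text \<open>
  All relations of an offset reduce to two scalar constants. The condition on the dual
  \<open>t\<close>-vectors says that corresponding central normals are the same oriented line. Its real
  part is \<open>t1 = t\<close>. As \<open>e1\<close>, \<open>e\<close> and \<open>g\<close> are orthogonal to \<open>t\<close>, while their derivatives are
  multiples of \<open>t\<close>, the products \<open>e1 \<bullet> e = cos \<theta>\<close> and \<open>e1 \<bullet> g = - sin \<theta>\<close> have derivative
  zero, so that the offset angle is constant (\<open>cos_sin_const\<close>). The dual part says
  that the striction points differ by a multiple of \<open>t\<close>, and comparison with the dual part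
  of the angle relation identifies the factor as the offset distance
  (\<open>striction_point_offset\<close>). Differentiating \<open>c1 = c + \<theta>s t\<close> and taking the product with \<open>t\<close>
  shows that the offset distance is constant as well, because both striction conditions remove
  the velocities of \<open>c\<close> and \<open>c1\<close>.

  With constant coefficients one may differentiate \<open>e1 = cos \<theta> e - sin \<theta> g\<close> and
  \<open>c1 = c + \<theta>s t\<close> by the frame equations. The first gives
  \<open>phi' = cos \<theta> + \<gamma> sin \<theta>\<close>; the product of the second with \<open>g1 = sin \<theta> e + cos \<theta> g\<close> gives
  \<open>phi' \<Delta>1 = \<delta> sin \<theta> + \<Delta> cos \<theta> + \<theta>s (\<gamma> cos \<theta> - sin \<theta>)\<close>, where
  \<open>\<delta> = \<gamma> \<Delta> + \<gamma>*\<close>. These are the derivatives of the two assertions, and both sides of each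
  assertion vanish at the common base point.
\<close>

section \<open>Calculus on an interval\<close>

lemma DERIV_int0:
  assumes I: "open I" "is_interval I" "0 \<in> I" and f: "continuous_on I f" and x: "x \<in> I"
  shows "(int0 f has_real_derivative f x) (at x)"
proof -
  (* The fundamental theorem is applied on a closed interval {a..b} that contains the base
     point 0 and has x in its interior, on whichever side of 0 the point x lies. *)
  obtain r where r: "r > 0" "cball x r \<subseteq> I"
    using open_contains_cball[of I] I x by blast
  obtain q where q: "q > 0" "cball 0 q \<subseteq> I"
    using open_contains_cball[of I] I by blast
  define a where "a = min (x - r) (- q)"
  define b where "b = max (x + r) q"
  have "x - r \<in> I" "x + r \<in> I" "- q \<in> I" "q \<in> I"
    using r q by (auto simp: dist_real_def subset_iff)
  then have ab: "a \<in> I" "b \<in> I"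
    by (auto simp: a_def b_def min_def max_def)
  have sub: "{a..b} \<subseteq> I"
    using mem_is_interval_1_I[OF I(2) ab] by auto
  have lt: "a < x" "x < b" "a \<le> 0" "0 \<le> b"
    using r q by (auto simp: a_def b_def)
  have "((\<lambda>u. LBINT y=ereal 0..ereal u. f y) has_vector_derivative f x) (at x within {a..b})"
    by (rule interval_integral_FTC2) (use lt continuous_on_subset[OF f sub] in auto)
  then have "(int0 f has_vector_derivative f x) (at x within {a..b})"
    by (simp add: int0_def[abs_def])
  moreover have "at x within {a..b} = at x"
    using lt by (intro at_within_interior) auto
  ultimately show ?thesis
    by (simp add: has_real_derivative_iff_has_vector_derivative)
qed

lemma int0_0 [simp]: "int0 f 0 = 0"
  by (simp add: int0_def)

lemma DERIV_0_interval_eq: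
  fixes f :: "real \<Rightarrow> real"
  assumes I: "is_interval I" and f: "\<And>u. u \<in> I \<Longrightarrow> (f has_real_derivative 0) (at u)"
    and "x \<in> I" "y \<in> I"
  shows "f x = f y"
proof -
  have "\<exists>k. \<forall>u\<in>I. f u = k"
    by (rule has_field_derivative_zero_constant)
      (use I f in \<open>auto simp: is_interval_convex intro: has_field_derivative_at_within\<close>)
  then show ?thesis using assms by auto
qed

lemma DERIV_inner:
  fixes f g :: "real \<Rightarrow> real^3"
  assumes "(f has_vector_derivative f') (at u)" "(g has_vector_derivative g') (at u)"
  shows "((\<lambda>u. f u \<bullet> g u) has_real_derivative f u \<bullet> g' + f' \<bullet> g u) (at u)"
  unfolding has_real_derivative_iff_has_vector_derivative
  by (rule bounded_bilinear.has_vector_derivative[OF bounded_bilinear_inner assms])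

section \<open>The moving frame of a ruled surface\<close>

locale ruled =
  fixes I :: "real set" and c e :: "real \<Rightarrow> real^3"
  assumes ruled: "ruled_surface I c e"
begin

lemma dom: "open I" "is_interval I" "0 \<in> I"
  using ruled by (auto simp: ruled_surface_def)

lemma has_vderiv:
  assumes "u \<in> I"
  shows "(c has_vector_derivative vderiv c u) (at u)"
    "(e has_vector_derivative tvec e u) (at u)"
    "(tvec e has_vector_derivative vderiv (tvec e) u) (at u)"
  using ruled smooth_curve_on_vderiv[of I _ u] assms
  by (auto simp: ruled_surface_def tvec_def)

lemma frame_inner:
  assumes u: "u \<in> I"
  shows "e u \<bullet> e u = 1" "tvec e u \<bullet> tvec e u = 1" "e u \<bullet> tvec e u = 0"
    "e u \<bullet> gvec e u = 0" "tvec e u \<bullet> gvec e u = 0" "gvec e u \<bullet> gvec e u = 1"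
    "vderiv c u \<bullet> tvec e u = 0"
proof -
  have ee: "\<And>v. v \<in> I \<Longrightarrow> e v \<bullet> e v = 1"
    using ruled by (auto simp: ruled_surface_def)
  show 1: "e u \<bullet> e u = 1" "tvec e u \<bullet> tvec e u = 1" "vderiv c u \<bullet> tvec e u = 0"
    using ruled u by (auto simp: ruled_surface_def tvec_def)
  show 2: "e u \<bullet> tvec e u = 0"
    using deriv_inner_const[OF dom(1) u ee has_vderiv(2)[OF u] has_vderiv(2)[OF u]]
    by (simp add: inner_commute)
  show "e u \<bullet> gvec e u = 0" "tvec e u \<bullet> gvec e u = 0"
    by (simp_all add: gvec_def dot_cross_self)
  show "gvec e u \<bullet> gvec e u = 1"
    using 1 2 by (simp add: gvec_def dot_cross inner_commute)
qed

lemma frame_cross: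
  assumes u: "u \<in> I"
  shows "tvec e u \<times> gvec e u = e u" "tvec e u \<times> e u = - gvec e u"
  using frame_inner[OF u] by (simp_all add: gvec_def Lagrange cross_skew[of "tvec e u" "e u"] inner_commute)

lemma frame_deriv:
  assumes u: "u \<in> I"
  shows "vderiv (tvec e) u = conical_curv e u *\<^sub>R gvec e u - e u"
    "(gvec e has_vector_derivative - conical_curv e u *\<^sub>R tvec e u) (at u)"
proof -
  have eqs: "vderiv (tvec e) u = conical_curv e u *\<^sub>R gvec e u - e u \<and>
      vderiv (gvec e) u = - conical_curv e u *\<^sub>R tvec e u"
    unfolding conical_curv_def by (rule theI'[OF ex1_conical_curv[OF ruled u]])
  then show "vderiv (tvec e) u = conical_curv e u *\<^sub>R gvec e u - e u" by simp
  have "((\<lambda>u. e u \<times> tvec e u) has_vector_derivative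
      (e u \<times> vderiv (tvec e) u + tvec e u \<times> tvec e u)) (at u)"
    by (rule bounded_bilinear.has_vector_derivative[OF
          bilinear_conv_bounded_bilinear[THEN iffD1, OF bilinear_cross]
          has_vderiv(2,3)[OF u]])
  then have "(gvec e has_vector_derivative vderiv (gvec e) u) (at u)"
    unfolding vderiv_def gvec_def[abs_def]
    by (metis vector_derivative_at)
  with eqs show "(gvec e has_vector_derivative - conical_curv e u *\<^sub>R tvec e u) (at u)"
    by simp
qed

lemma Delta_eq: "Delta c e u = vderiv c u \<bullet> gvec e u"
  by (simp add: Delta_def gvec_def dot_cross_det)

text \<open>Shows that the conical curvature, given by a definite description, depends continuously on \<open>u\<close>.\<close>

lemma conical_curv_eq:
  assumes "u \<in> I" shows "conical_curv e u = vderiv (tvec e) u \<bullet> gvec e u"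
  using frame_inner[OF assms] by (simp add: frame_deriv(1)[OF assms] inner_diff_left)

lemma continuous_frame:
  "continuous_on I (vderiv c)" "continuous_on I e" "continuous_on I (gvec e)"
  "continuous_on I (conical_curv e)" "continuous_on I (Delta c e)"
  "continuous_on I (delta c e)"
proof -
  have c1: "(vderiv ^^ 1) c differentiable at u" and e2: "(vderiv ^^ 2) e differentiable at u"
    if "u \<in> I" for u
    using ruled that unfolding ruled_surface_def smooth_curve_on_def by blast+
  show 1: "continuous_on I (vderiv c)"
    using c1 by (auto intro!: continuous_at_imp_continuous_on differentiable_imp_continuous_within)
  have t': "continuous_on I (vderiv (tvec e))"
    using e2 by (auto simp: tvec_def numeral_2_eq_2
        intro!: continuous_at_imp_continuous_on differentiable_imp_continuous_within)
  show 2: "continuous_on I e"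
    using has_vderiv(2)
    by (auto intro!: continuous_at_imp_continuous_on has_vector_derivative_continuous)
  show 3: "continuous_on I (gvec e)"
    using frame_deriv(2)
    by (blast intro!: continuous_at_imp_continuous_on has_vector_derivative_continuous)
  have "continuous_on I (\<lambda>u. vderiv (tvec e) u \<bullet> gvec e u)"
    by (intro continuous_intros t' 3)
  then show "continuous_on I (conical_curv e)"
    by (simp add: conical_curv_eq cong: continuous_on_cong)
  show "continuous_on I (Delta c e)"
    unfolding Delta_eq[abs_def] by (intro continuous_intros 1 3)
  show "continuous_on I (delta c e)"
    unfolding delta_def[abs_def] by (intro continuous_intros 1 2)
qed

end

section \<open>Constancy of the dual offset angle\<close>

locale bertrand_pair = S: ruled I c e + S1: ruled I1 c1 e1
  for I c e I1 c1 e1 +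
  fixes phi \<theta> \<theta>s :: "real \<Rightarrow> real"
  assumes offset: "bertrand_offset I c e I1 c1 e1 phi"
    and angle: "\<And>u. u \<in> I \<Longrightarrow> dual_offset_angle c e c1 e1 phi u (Dual (\<theta> u) (\<theta>s u))"
begin

abbreviation "\<gamma> \<equiv> conical_curv e"

lemma phi_in: "u \<in> I \<Longrightarrow> phi u \<in> I1"
  using offset by (auto simp: bertrand_offset_def)

lemma phi_0: "phi 0 = 0"
  using offset by (auto simp: bertrand_offset_def)

lemma DERIV_phi: "u \<in> I \<Longrightarrow> (phi has_real_derivative deriv phi u) (at u)"
  using offset by (auto simp: bertrand_offset_def DERIV_deriv_iff_real_differentiable)

lemma has_vderiv_comp_phi:
  assumes "u \<in> I" "(f has_vector_derivative f') (at (phi u))"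
  shows "((\<lambda>u. f (phi u)) has_vector_derivative deriv phi u *\<^sub>R f') (at u)"
  using vector_diff_chain_at[of phi "deriv phi u" u f f'] DERIV_phi[OF assms(1)] assms(2)
  by (simp add: o_def has_real_derivative_iff_has_vector_derivative)

lemma t1_eq: "u \<in> I \<Longrightarrow> tvec e1 (phi u) = tvec e u"
  using offset by (auto simp: bertrand_offset_def dual_t_def dual_line_def)

lemma e1_eq: "u \<in> I \<Longrightarrow> e1 (phi u) = cos (\<theta> u) *\<^sub>R e u - sin (\<theta> u) *\<^sub>R gvec e u"
  using angle[of u]
  by (auto simp: dual_offset_angle_def dual_e_def dual_g_def dual_line_def dual_scale_def
      dual_ext_def minus_dual_def)

text \<open>
  The cosine and sine are the coordinates of \<open>e1\<close> along \<open>e\<close> and \<open>- g\<close>. In the derivative of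
  either product each term pairs a vector orthogonal to \<open>t\<close> with a multiple of \<open>t = t1\<close>.
\<close>

lemma cos_sin_const:
  assumes "u \<in> I" "v \<in> I"
  shows "cos (\<theta> u) = cos (\<theta> v)" "sin (\<theta> u) = sin (\<theta> v)"
proof -
  have cs: "e1 (phi w) \<bullet> e w = cos (\<theta> w)" "e1 (phi w) \<bullet> gvec e w = - sin (\<theta> w)"
    and e1t: "e1 (phi w) \<bullet> tvec e w = 0" if "w \<in> I" for w
    using S.frame_inner[OF that]
    by (simp_all add: e1_eq[OF that] inner_diff_left inner_diff_right inner_commute)
  have e1': "((\<lambda>w. e1 (phi w)) has_vector_derivative deriv phi w *\<^sub>R tvec e w) (at w)"
    if "w \<in> I" for w
    using has_vderiv_comp_phi[OF that S1.has_vderiv(2)[OF phi_in[OF that]]] that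
    by (simp add: t1_eq)
  have "((\<lambda>w. e1 (phi w) \<bullet> e w) has_real_derivative 0) (at w)" if "w \<in> I" for w
    using DERIV_inner[OF e1'[OF that] S.has_vderiv(2)[OF that]] S.frame_inner[OF that] e1t[OF that]
    by (simp add: inner_commute)
  from DERIV_0_interval_eq[OF S.dom(2) this assms]
  show "cos (\<theta> u) = cos (\<theta> v)" using assms by (simp add: cs)
  have "((\<lambda>w. e1 (phi w) \<bullet> gvec e w) has_real_derivative 0) (at w)" if "w \<in> I" for w
    using DERIV_inner[OF e1'[OF that] S.frame_deriv(2)[OF that]] S.frame_inner[OF that] e1t[OF that]
    by (simp add: inner_commute)
  from DERIV_0_interval_eq[OF S.dom(2) this assms]
  show "sin (\<theta> u) = sin (\<theta> v)" using assms by (simp add: cs)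
qed

text \<open>
  Equal moments \<open>c1 \<times> t = c \<times> t\<close> force \<open>c1 - c = l t\<close>. The dual part of the angle relation
  then reads \<open>l (sin \<theta> e + cos \<theta> g) = \<theta>s (sin \<theta> e + cos \<theta> g)\<close>, and the vector is a unit vector.
\<close>

lemma striction_point_offset:
  assumes u: "u \<in> I"
  shows "c1 (phi u) = c u + \<theta>s u *\<^sub>R tvec e u"
proof -
  define d where "d = c1 (phi u) - c u"
  define l where "l = tvec e u \<bullet> d"
  define w where "w = sin (\<theta> u) *\<^sub>R e u + cos (\<theta> u) *\<^sub>R gvec e u"
  note fi = S.frame_inner[OF u]
  have "c1 (phi u) \<times> tvec e u = c u \<times> tvec e u"
    using offset u t1_eq[OF u] by (auto simp: bertrand_offset_def dual_t_def dual_line_def)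
  then have "tvec e u \<times> d = 0"
    by (simp add: d_def cross_skew[of "tvec e u"] Cross3.left_diff_distrib)
  then have d: "d = l *\<^sub>R tvec e u"
    using Lagrange[of "tvec e u" "tvec e u" d] fi by (simp add: l_def)
  have dc: "deriv cos (\<theta> u) = - sin (\<theta> u)" "deriv sin (\<theta> u) = cos (\<theta> u)"
    by (auto intro!: DERIV_imp_deriv derivative_eq_intros)
  have "c1 (phi u) \<times> e1 (phi u) =
      (cos (\<theta> u) *\<^sub>R (c u \<times> e u) + (- \<theta>s u * sin (\<theta> u)) *\<^sub>R e u)
      - (sin (\<theta> u) *\<^sub>R (c u \<times> gvec e u) + (\<theta>s u * cos (\<theta> u)) *\<^sub>R gvec e u)"
    using angle[OF u]
    by (auto simp: dual_offset_angle_def dual_e_def dual_g_def dual_line_def dual_scale_def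
        dual_ext_def minus_dual_def dc)
  also have "\<dots> = c u \<times> e1 (phi u) - \<theta>s u *\<^sub>R w"
    by (simp add: e1_eq[OF u] w_def Cross3.right_diff_distrib cross_mult_right algebra_simps)
  finally have "d \<times> e1 (phi u) = - \<theta>s u *\<^sub>R w"
    by (simp add: d_def Cross3.left_diff_distrib)
  moreover have "d \<times> e1 (phi u) = - l *\<^sub>R w"
    by (simp add: d e1_eq[OF u] w_def Cross3.right_diff_distrib cross_mult_right cross_mult_left
        S.frame_cross[OF u] algebra_simps)
  ultimately have "l *\<^sub>R w = \<theta>s u *\<^sub>R w" by simp
  moreover have "w \<bullet> w = 1"
    using fi by (simp add: w_def inner_add_left inner_add_right inner_commute
        flip: power2_eq_square)
  then have "w \<noteq> 0" by auto
  ultimately have "l = \<theta>s u" by simp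
  then show ?thesis using d by (simp add: d_def algebra_simps)
qed

text \<open>
  In the derivative of \<open>\<theta>s = (c1 - c) \<bullet> t\<close> the velocities of both striction lines are
  orthogonal to \<open>t = t1\<close>, and \<open>c1 - c\<close> is a multiple of \<open>t\<close>, hence orthogonal to \<open>t'\<close>.
\<close>

lemma offset_distance_const:
  assumes "u \<in> I" "v \<in> I"
  shows "\<theta>s u = \<theta>s v"
proof -
  have th: "(c1 (phi w) - c w) \<bullet> tvec e w = \<theta>s w" if "w \<in> I" for w
    using S.frame_inner[OF that] by (simp add: striction_point_offset[OF that])
  have "((\<lambda>w. (c1 (phi w) - c w) \<bullet> tvec e w) has_real_derivative 0) (at w)" if w: "w \<in> I" for w
  proof -
    have c1: "((\<lambda>w. c1 (phi w) - c w) has_vector_derivative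
        deriv phi w *\<^sub>R vderiv c1 (phi w) - vderiv c w) (at w)"
      by (intro has_vector_derivative_diff has_vderiv_comp_phi w S1.has_vderiv(1) phi_in
          S.has_vderiv(1))
    have "vderiv c1 (phi w) \<bullet> tvec e w = 0"
      using S1.frame_inner(7)[OF phi_in[OF w]] t1_eq[OF w] by simp
    then show ?thesis
      using DERIV_inner[OF c1 S.has_vderiv(3)[OF w]] S.frame_inner[OF w]
      by (simp add: striction_point_offset[OF w] S.frame_deriv(1)[OF w] inner_diff_left
          inner_diff_right inner_commute)
  qed
  from DERIV_0_interval_eq[OF S.dom(2) this assms] th assms show ?thesis by simp
qed

section \<open>Velocities of corresponding parameters\<close>

text \<open>
  Both sides are the coefficient of \<open>t\<close> in the derivative of \<open>e1\<close> along the correspondence: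
  the chain rule gives \<open>phi' t1\<close>, the frame equations with constant \<open>\<theta>\<close> the other value.
\<close>

lemma deriv_phi_eq:
  assumes u: "u \<in> I"
  shows "deriv phi u = cos (\<theta> u) + \<gamma> u * sin (\<theta> u)"
proof -
  have "((\<lambda>w. cos (\<theta> u) *\<^sub>R e w - sin (\<theta> u) *\<^sub>R gvec e w) has_vector_derivative
      cos (\<theta> u) *\<^sub>R tvec e u - sin (\<theta> u) *\<^sub>R (- \<gamma> u *\<^sub>R tvec e u)) (at u)"
    using S.has_vderiv(2)[OF u] S.frame_deriv(2)[OF u]
    by (intro has_vector_derivative_diff bounded_linear.has_vector_derivative[OF
          bounded_linear_scaleR_right])
  then have "((\<lambda>w. e1 (phi w)) has_vector_derivative
      cos (\<theta> u) *\<^sub>R tvec e u - sin (\<theta> u) *\<^sub>R (- \<gamma> u *\<^sub>R tvec e u)) (at u)"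
    by (rule has_vector_derivative_transform_within_open[OF _ S.dom(1) u])
      (simp add: e1_eq cos_sin_const[OF _ u])
  then have "((\<lambda>w. e1 (phi w)) has_vector_derivative
      (cos (\<theta> u) + \<gamma> u * sin (\<theta> u)) *\<^sub>R tvec e u) (at u)"
    by (simp add: algebra_simps)
  moreover have "((\<lambda>w. e1 (phi w)) has_vector_derivative deriv phi u *\<^sub>R tvec e u) (at u)"
    using has_vderiv_comp_phi[OF u S1.has_vderiv(2)[OF phi_in[OF u]]] u by (simp add: t1_eq)
  ultimately have "deriv phi u *\<^sub>R tvec e u = (cos (\<theta> u) + \<gamma> u * sin (\<theta> u)) *\<^sub>R tvec e u"
    by (rule vector_derivative_unique_at[rotated])
  moreover have "tvec e u \<noteq> 0" using S.frame_inner(2)[OF u] by auto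
  ultimately show ?thesis by simp
qed

lemma g1_eq:
  assumes u: "u \<in> I"
  shows "gvec e1 (phi u) = sin (\<theta> u) *\<^sub>R e u + cos (\<theta> u) *\<^sub>R gvec e u"
proof -
  have "gvec e1 (phi u) = - (tvec e u \<times> e1 (phi u))"
    by (simp add: gvec_def[of e1] t1_eq[OF u] cross_skew[of "tvec e u"])
  then show ?thesis
    by (simp add: e1_eq[OF u] Cross3.right_diff_distrib cross_mult_right S.frame_cross[OF u])
qed

text \<open>
  Since \<open>\<Delta>1\<close> is the component of the velocity of \<open>c1\<close> along \<open>g1\<close>, the left side is
  the component along \<open>g1\<close> of the derivative of \<open>c1 = c + \<theta>s t\<close> with respect to the
  parameter of the first surface.
\<close>

lemma Delta1_deriv_phi:
  assumes u: "u \<in> I"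
  shows "Delta c1 e1 (phi u) * deriv phi u =
    delta c e u * sin (\<theta> u) + Delta c e u * cos (\<theta> u)
      + \<theta>s u * (\<gamma> u * cos (\<theta> u) - sin (\<theta> u))"
proof -
  have "((\<lambda>w. c w + \<theta>s u *\<^sub>R tvec e w) has_vector_derivative
      vderiv c u + \<theta>s u *\<^sub>R vderiv (tvec e) u) (at u)"
    using S.has_vderiv[OF u]
    by (intro has_vector_derivative_add bounded_linear.has_vector_derivative[OF
          bounded_linear_scaleR_right])
  then have "((\<lambda>w. c1 (phi w)) has_vector_derivative
      vderiv c u + \<theta>s u *\<^sub>R vderiv (tvec e) u) (at u)"
    by (rule has_vector_derivative_transform_within_open[OF _ S.dom(1) u])
      (simp add: striction_point_offset offset_distance_const[OF _ u])
  from vector_derivative_unique_at[OF has_vderiv_comp_phi[OF u S1.has_vderiv(1)[OF phi_in[OF u]]] this]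
  have eq: "deriv phi u *\<^sub>R vderiv c1 (phi u) = vderiv c u + \<theta>s u *\<^sub>R (\<gamma> u *\<^sub>R gvec e u - e u)"
    by (simp add: S.frame_deriv(1)[OF u])
  have "Delta c1 e1 (phi u) * deriv phi u =
      (deriv phi u *\<^sub>R vderiv c1 (phi u)) \<bullet> gvec e1 (phi u)"
    by (simp add: S1.Delta_eq)
  also have "\<dots> = delta c e u * sin (\<theta> u) + Delta c e u * cos (\<theta> u)
      + \<theta>s u * (\<gamma> u * cos (\<theta> u) - sin (\<theta> u))"
    unfolding eq g1_eq[OF u] using S.frame_inner[OF u]
    by (simp add: S.Delta_eq delta_def inner_add_left inner_add_right inner_diff_left
        inner_diff_right inner_commute algebra_simps)
  finally show ?thesis .
qed

section \<open>Integrated relations\<close>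

lemma phi_eq:
  assumes s: "s \<in> I"
  shows "phi s = s * cos (\<theta> s) + int0 \<gamma> s * sin (\<theta> s)"
proof -
  define F where "F u = phi u - (u * cos (\<theta> s) + int0 \<gamma> u * sin (\<theta> s))" for u
  have "(F has_real_derivative 0) (at u)" if u: "u \<in> I" for u
    unfolding F_def using deriv_phi_eq[OF u] cos_sin_const[OF u s]
    by (auto intro!: derivative_eq_intros DERIV_phi[OF u]
        DERIV_int0[OF S.dom S.continuous_frame(4) u])
  from DERIV_0_interval_eq[OF S.dom(2) this s S.dom(3)]
  show ?thesis by (simp add: F_def phi_0)
qed

lemma int0_Delta1_phi:
  assumes s: "s \<in> I"
  shows "int0 (Delta c1 e1) (phi s) =
    int0 (delta c e) s * sin (\<theta> s) + int0 (Delta c e) s * cos (\<theta> s)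
      + \<theta>s s * (int0 \<gamma> s * cos (\<theta> s) - s * sin (\<theta> s))"
proof -
  define F where "F u = int0 (Delta c1 e1) (phi u) -
    (int0 (delta c e) u * sin (\<theta> s) + int0 (Delta c e) u * cos (\<theta> s)
      + \<theta>s s * (int0 \<gamma> u * cos (\<theta> s) - u * sin (\<theta> s)))" for u
  have "(F has_real_derivative 0) (at u)" if u: "u \<in> I" for u
    unfolding F_def
    using Delta1_deriv_phi[OF u] cos_sin_const[OF u s] offset_distance_const[OF u s]
    by (auto intro!: derivative_eq_intros
        DERIV_chain2[OF DERIV_int0[OF S1.dom S1.continuous_frame(5) phi_in[OF u]] DERIV_phi[OF u]]
        DERIV_int0[OF S.dom _ u] S.continuous_frame)
  from DERIV_0_interval_eq[OF S.dom(2) this s S.dom(3)]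
  show ?thesis by (simp add: F_def phi_0)
qed

end

theorem theorem4p3:
  fixes I I1 :: "real set"
    and c e c1 e1 :: "real \<Rightarrow> real^3"
    and phi \<theta> \<theta>s :: "real \<Rightarrow> real"
  assumes surface: "ruled_surface I c e"
    and surface1: "ruled_surface I1 c1 e1"
    and offset: "bertrand_offset I c e I1 c1 e1 phi"
    and angle: "\<And>s. s \<in> I \<Longrightarrow> dual_offset_angle c e c1 e1 phi s (Dual (\<theta> s) (\<theta>s s))"
    and s: "s \<in> I"
  shows "phi s = s * cos (\<theta> s) + int0 (conical_curv e) s * sin (\<theta> s) \<and>
    int0 (Delta c1 e1) (phi s) =
        int0 (\<lambda>u. conical_curv e u * Delta c e u + du (dual_conical_curv c e u)) s
          * sin (\<theta> s)
      + int0 (Delta c e) s * cos (\<theta> s)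
      + \<theta>s s * (int0 (conical_curv e) s * cos (\<theta> s) - s * sin (\<theta> s))"
proof -
  interpret bertrand_pair I c e I1 c1 e1 phi \<theta> \<theta>s
    using assms by unfold_locales auto
  have "(\<lambda>u. conical_curv e u * Delta c e u + du (dual_conical_curv c e u)) = delta c e"
    by (simp add: dual_conical_curv_def)
  then show ?thesis
    using phi_eq[OF s] int0_Delta1_phi[OF s] by simp
qed

end
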